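(* Let $r\ge 1$ be an integer and $\lambda_r\in\mathbb{C}\setminus\{0,1\}$. Let $\lambda^{d}_{n,m}$ be defined by $P^{d}_n(\lambda_r;r)(x)=\sum_{m=0}^{n}\lambda^{d}_{n,m}P_m(x)$. Then: \begin{enumerate} \item For $0\le k\le r$: $P^{d}_{k}(\lambda_r;r)(x)=P_k(x)$; that is, $\lambda^{d}_{k,k}=1$ and $\lambda^{d}_{k,m}=0$ for $0\le m\le k-1$. \item For $r+1\le k\le 2r-1$: $$P^{d}_{k}(\lambda_r;r)(x)=P_k(x)+\frac{1-\lambda_r}{4}\sum_{i=1}^{k-r}\frac{1}{4^{i-1}}P_{k-2i}(x);$$ that is, $\lambda^{d}_{k,k}=1$; $\lambda^{d}_{k,k-2i+1}=0$ and $\lambda^{d}_{k,k-2i}=(1-\lambda_r)/4^i$ for $1\le i\le k-r$; and $\lambda^{d}_{k,m}=0$ for $0\le m\le 2r-k-1$. \item For $n\ge 0$: $$P^{d}_{n+2r}(\lambda_r;r)(x)=P_{n+2r}(x)+\frac{1-\lambda_r}{4}\sum_{i=1}^{r}\frac{1}{4^{i-1}}P_{n+2(r-i)}(x);$$ that is, $\lambda^{d}_{n+2r,n+2r}=1$; $\lambda^{d}_{n+2r,n+2(r-i)+1}=0$ and $\lambda^{d}_{n+2r,n+2(r-i)}=(1-\lambda_r)/4^i$ for $1\le i\le r$; and $\lambda^{d}_{n+2r,m}=0$ for $0\le m\le n-1$. \end{enumerate}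
   Context: $\{P_n\}_{n\ge0}$ denotes the monic Chebyshev polynomials of the second kind: $P_0=1$, $P_1=x$, $P_{n+2}(x)=xP_{n+1}(x)-\frac14P_n(x)$ for $n\ge 0$. For an integer $r\ge 1$ and $\lambda_r\in\mathbb{C}\setminus\{0,1\}$, the $r$th-perturbed sequence by dilatation $\{P^d_n(\lambda_r;r)\}_{n\ge 0}$ is the monic sequence with $P^d_0=1$, $P^d_1(x)=x$, $P^d_{n+2}(x)=xP^d_{n+1}(x)-\gamma_{n+1}P^d_n(x)$ for $n\ge 0$, where $\gamma_r=\lambda_r/4$ and $\gamma_{n+1}=1/4$ for $n\ge 0$, $n\ne r-1$. Index ranges whose upper bound is smaller than the lower bound are empty. *)

theory Defs
  imports Complex_Main "HOL-Computational_Algebra.Polynomial"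
begin

fun cheb2 :: "nat \<Rightarrow> complex poly" where
  "cheb2 0 = 1"
| "cheb2 (Suc 0) = [:0, 1:]"
| "cheb2 (Suc (Suc n)) = [:0, 1:] * cheb2 (Suc n) - smult (1 / 4) (cheb2 n)"

text \<open>Recurrence coefficients; only the values at indices \<open>n \<ge> 1\<close> are used.\<close>

definition dil_gamma :: "complex \<Rightarrow> nat \<Rightarrow> nat \<Rightarrow> complex" where
  "dil_gamma lam r n = (if n = r then lam / 4 else 1 / 4)"

fun cheb2_dil :: "complex \<Rightarrow> nat \<Rightarrow> nat \<Rightarrow> complex poly" where
  "cheb2_dil lam r 0 = 1"
| "cheb2_dil lam r (Suc 0) = [:0, 1:]"
| "cheb2_dil lam r (Suc (Suc n)) =
     [:0, 1:] * cheb2_dil lam r (Suc n) - smult (dil_gamma lam r (Suc n)) (cheb2_dil lam r n)"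

lemma degree_cheb2_le: "degree (cheb2 n) \<le> n"
proof (induction n rule: cheb2.induct)
  case (3 n)
  have "degree ([:0, 1:] * cheb2 (Suc n)) \<le> Suc (Suc n)"
    using 3 degree_mult_le[of "[:0, 1:]" "cheb2 (Suc n)"] by simp
  moreover have "degree (smult (1 / 4) (cheb2 n)) \<le> Suc (Suc n)"
    using 3 by simp
  ultimately show ?case by (simp only: cheb2.simps degree_diff_le)
qed auto

lemma coeff_cheb2_top: "coeff (cheb2 n) n = 1"
proof (induction n rule: cheb2.induct)
  case (3 n)
  have "coeff (cheb2 n) (Suc (Suc n)) = 0"
    using degree_cheb2_le[of n] by (intro coeff_eq_0) simp
  with 3 show ?case by simp
qed auto

lemma degree_cheb2_dil_le: "degree (cheb2_dil lam r n) \<le> n"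
proof (induction lam r n rule: cheb2_dil.induct)
  case (3 lam r n)
  have "degree ([:0, 1:] * cheb2_dil lam r (Suc n)) \<le> Suc (Suc n)"
    using 3 degree_mult_le[of "[:0, 1:]" "cheb2_dil lam r (Suc n)"] by simp
  moreover have "degree (smult (dil_gamma lam r (Suc n)) (cheb2_dil lam r n)) \<le> Suc (Suc n)"
    using 3 degree_smult_le[of "dil_gamma lam r (Suc n)" "cheb2_dil lam r n"] by simp
  ultimately show ?case by (simp only: cheb2_dil.simps degree_diff_le)
qed auto

lemma cheb2_expansion_ex:
  assumes "degree q \<le> n"
  shows "\<exists>c. q = (\<Sum>m=0..n. smult (c m) (cheb2 m))"
  using assms
proof (induction n arbitrary: q)
  case 0
  then obtain a where "q = [:a:]" by (auto elim: degree_eq_zeroE)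
  then show ?case by (intro exI[of _ "\<lambda>_. a"]) simp
next
  case (Suc n)
  define a where "a = coeff q (Suc n)"
  define q' where "q' = q - smult a (cheb2 (Suc n))"
  have "degree q' \<le> n"
  proof (rule degree_le, intro allI impI)
    fix i assume "n < i"
    show "coeff q' i = 0"
    proof (cases "i = Suc n")
      case True
      then show ?thesis by (simp add: q'_def a_def coeff_cheb2_top del: cheb2.simps)
    next
      case False
      with \<open>n < i\<close> have "i > Suc n" by simp
      then have "coeff q i = 0" "coeff (cheb2 (Suc n)) i = 0"
        using Suc.prems degree_cheb2_le[of "Suc n"] by (auto intro!: coeff_eq_0)
      then show ?thesis by (simp add: q'_def)
    qed
  qed
  then obtain c where c: "q' = (\<Sum>m=0..n. smult (c m) (cheb2 m))"
    using Suc.IH by blast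
  have "(\<Sum>m=0..n. smult ((c(Suc n := a)) m) (cheb2 m)) = q'"
    unfolding c by (rule sum.cong) auto
  then have "q = (\<Sum>m=0..Suc n. smult ((c(Suc n := a)) m) (cheb2 m))"
    by (simp add: q'_def)
  then show ?case by blast
qed

text \<open>Connection coefficients between the two sequences exist, so requiring a
  family to satisfy the expansion below is never vacuous.\<close>

lemma connection_coeffs_ex:
  "\<exists>c. \<forall>n. cheb2_dil lam r n = (\<Sum>m=0..n. smult (c n m) (cheb2 m))"
  using cheb2_expansion_ex[OF degree_cheb2_dil_le] by (intro choice allI)

end

theory Submission
  imports Defs
begin

text \<open>Past the perturbed index, the difference between the two sequences obeys the Chebyshev
  recurrence, so it is a constant times \<open>P\<^sub>r\<^sub>-\<^sub>1 P\<^sub>k\<^sub>-\<^sub>r\<^sub>-\<^sub>1\<close>. Iterating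
  \<open>P\<^sub>a\<^sub>+\<^sub>1 P\<^sub>b\<^sub>+\<^sub>1 = P\<^sub>a\<^sub>+\<^sub>b\<^sub>+\<^sub>2 + 1/4 P\<^sub>a P\<^sub>b\<close> linearises this product; the sum stops after
  \<open>min r (k - r)\<close> terms, which is the split between the last two cases.\<close>

text \<open>For fixed \<open>b\<close> both sides satisfy the Chebyshev recurrence in
  \<open>a\<close>, and at \<open>a = 0\<close> the claim is that recurrence itself.\<close>

lemma cheb2_mult_Suc_Suc:
  "cheb2 (Suc a) * cheb2 (Suc b) = cheb2 (Suc (Suc (a + b))) + smult (1 / 4) (cheb2 a * cheb2 b)"
proof (induction a arbitrary: b rule: cheb2.induct)
  case (3 n)
  have "cheb2 (Suc (Suc (Suc n))) * cheb2 (Suc b)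
      = [:0, 1:] * (cheb2 (Suc (Suc n)) * cheb2 (Suc b))
        - smult (1 / 4) (cheb2 (Suc n) * cheb2 (Suc b))"
    by (simp only: cheb2.simps(3)[of "Suc n"] left_diff_distrib mult.assoc mult_smult_left)
  also have "\<dots> = [:0, 1:] * cheb2 (Suc (Suc (Suc n + b))) - smult (1 / 4) (cheb2 (Suc (Suc (n + b))))
        + smult (1 / 4) (([:0, 1:] * cheb2 (Suc n) - smult (1 / 4) (cheb2 n)) * cheb2 b)"
    by (simp only: 3 distrib_left left_diff_distrib smult_add_right smult_diff_right
        mult_smult_left mult_smult_right mult.assoc) (simp only: algebra_simps)
  finally show ?case by simp
qed (simp_all add: algebra_simps)

lemma smult_sum_right: "smult a (sum f A) = (\<Sum>i\<in>A. smult a (f i))"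
  by (induction A rule: infinite_finite_induct) (simp_all add: smult_add_right)

text \<open>Each product step lowers both indices by one and keeps their difference
  \<open>d\<close>, ending at \<open>cheb2 0 * cheb2 d\<close>. Up to rescaling, this is the
  classical product formula for second-kind Chebyshev polynomials.\<close>

lemma cheb2_mult:
  "cheb2 n * cheb2 (n + d) = (\<Sum>i=0..n. smult (1 / 4 ^ i) (cheb2 (2 * (n - i) + d)))"
proof (induction n)
  case (Suc n)
  have "(\<Sum>i=0..Suc n. smult (1 / 4 ^ i) (cheb2 (2 * (Suc n - i) + d)))
      = cheb2 (2 * Suc n + d) + smult (1 / 4) (\<Sum>i=0..n. smult (1 / 4 ^ i) (cheb2 (2 * (n - i) + d)))"
    by (simp only: sum.atLeast0_atMost_Suc_shift smult_sum_right) (simp add: o_def del: cheb2.simps)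
  then show ?case
    using cheb2_mult_Suc_Suc[of n "n + d"] by (simp add: Suc mult_2 add.assoc del: cheb2.simps)
qed simp

text \<open>The altered coefficient has index \<open>r\<close> and first enters at the polynomial of
  index \<open>r + 1\<close>.\<close>

lemma cheb2_dil_eq_cheb2: "k \<le> r \<Longrightarrow> cheb2_dil lam r k = cheb2 k"
  by (induction lam r k rule: cheb2_dil.induct) (auto simp: dil_gamma_def)

text \<open>At index \<open>Suc t + 1\<close>, using \<open>lam / 4\<close> instead of
  \<open>1 / 4\<close> leaves \<open>(1 - lam) / 4\<close> times \<open>cheb2 t\<close>. The next
  index multiplies this by x, and then the unperturbed recurrence takes over, so the cofactor runs
  through \<open>cheb2 j\<close>.\<close>

lemma cheb2_dil_eq_cheb2_plus:
  "cheb2_dil lam (Suc t) (Suc (Suc t) + j)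
    = cheb2 (Suc (Suc t) + j) + smult ((1 - lam) / 4) (cheb2 t * cheb2 j)"
proof (induction j rule: cheb2.induct)
  case 1
  have "smult ((1 - lam) / 4) p = smult (1 / 4) p - smult (lam / 4) p" for p
    by (simp add: diff_divide_distrib smult_diff_left)
  then show ?case by (simp add: cheb2_dil_eq_cheb2 dil_gamma_def)
next
  case 2
  have "smult ((1 - lam) / 4) p = smult (1 / 4) p - smult (lam / 4) p" for p
    by (simp add: diff_divide_distrib smult_diff_left)
  then show ?case
    by (simp add: cheb2_dil_eq_cheb2 dil_gamma_def algebra_simps)
next
  case (3 n)
  \<comment> \<open>The recurrence coefficient here has index \<open>t + n + 3\<close>, past the
    perturbed index \<open>Suc t\<close>, so it is \<open>1 / 4\<close>.\<close>
  have "cheb2_dil lam (Suc t) (Suc (Suc t) + Suc (Suc n))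
      = [:0, 1:] * cheb2_dil lam (Suc t) (Suc (Suc t) + Suc n)
        - smult (1 / 4) (cheb2_dil lam (Suc t) (Suc (Suc t) + n))"
    by (simp add: dil_gamma_def)
  also have "\<dots> = [:0, 1:] * cheb2 (Suc (Suc t) + Suc n) - smult (1 / 4) (cheb2 (Suc (Suc t) + n))
      + smult ((1 - lam) / 4) (cheb2 t * ([:0, 1:] * cheb2 (Suc n) - smult (1 / 4) (cheb2 n)))"
    unfolding 3 by (simp only: algebra_simps smult_add_right smult_diff_right
        mult_smult_left mult_smult_right smult_smult)
  finally show ?case by simp
qed

lemma cheb2_dil_expansion:
  assumes "1 \<le> r" "r < k"
  shows "cheb2_dil lam r k = cheb2 k
    + smult ((1 - lam) / 4) (\<Sum>i=1..min r (k - r). smult (1 / 4 ^ (i - 1)) (cheb2 (k - 2 * i)))"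
proof -
  obtain t where t: "r = Suc t" using assms by (cases r) auto
  obtain j where j: "k = Suc (Suc t) + j" using assms t less_eqE[of "Suc r" k] by auto
  define s where "s = min t j"
  have "cheb2 t * cheb2 j = cheb2 s * cheb2 (s + (max t j - s))"
    by (auto simp: s_def min_def max_def mult.commute)
  \<comment> \<open>The indices \<open>t\<close> and \<open>j\<close> add up to
    \<open>k - 2\<close>, so term \<open>i\<close> of the product formula has index
    \<open>k - 2 - 2 * i\<close>.\<close>
  also have "\<dots> = (\<Sum>i=0..s. smult (1 / 4 ^ i) (cheb2 (k - 2 * Suc i)))"
    unfolding cheb2_mult
    by (intro sum.cong refl arg_cong2[where f = smult] arg_cong[where f = cheb2])
      (auto simp: s_def j min_def max_def)
  also have "\<dots> = (\<Sum>i=1..Suc s. smult (1 / 4 ^ (i - 1)) (cheb2 (k - 2 * i)))"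
    by (simp only: One_nat_def sum.atLeast_Suc_atMost_Suc_shift o_def diff_Suc_Suc diff_zero)
  also have "Suc s = min r (k - r)" by (simp add: s_def t j)
  finally show ?thesis using cheb2_dil_eq_cheb2_plus[of lam t j] by (simp only: t j)
qed

text \<open>Each \<open>cheb2 m\<close> is monic of degree \<open>m\<close>, so the coefficient of
  degree \<open>n\<close> in the sum is \<open>c n\<close>; once it vanishes, the top term drops
  out.\<close>

lemma cheb2_independent:
  assumes "(\<Sum>m=0..n. smult (c m) (cheb2 m)) = 0" "m \<le> n"
  shows "c m = 0"
  using assms
proof (induction n)
  case (Suc n)
  have "coeff (cheb2 i) (Suc n) = 0" if "i \<le> n" for i
    using degree_cheb2_le[of i] that by (intro coeff_eq_0) simp
  then have "coeff (\<Sum>i=0..Suc n. smult (c i) (cheb2 i)) (Suc n) = c (Suc n)"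
    by (simp add: coeff_sum coeff_cheb2_top del: cheb2.simps)
  then have "c (Suc n) = 0" by (simp only: Suc.prems(1) coeff_0)
  with Suc show ?case by (cases "m = Suc n") auto
qed auto

text \<open>Filling the indices missed by \<open>f\<close> with zero coefficients reduces the
  comparison to linear independence.\<close>

lemma cheb2_expansion_unique:
  assumes eq: "(\<Sum>m=0..n. smult (c m) (cheb2 m)) = (\<Sum>i\<in>I. smult (a i) (cheb2 (f i)))"
    and I: "finite I" "inj_on f I" "\<And>i. i \<in> I \<Longrightarrow> f i \<le> n"
  shows "i \<in> I \<Longrightarrow> c (f i) = a i"
    and "m \<le> n \<Longrightarrow> m \<notin> f ` I \<Longrightarrow> c m = 0"
proof -
  define d where "d m = (if m \<in> f ` I then a (inv_into I f m) else 0)" for m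
  have "(\<Sum>i\<in>I. smult (a i) (cheb2 (f i))) = (\<Sum>m\<in>f ` I. smult (d m) (cheb2 m))"
    unfolding sum.reindex[OF I(2)] by (rule sum.cong) (auto simp: d_def I(2))
  also have "\<dots> = (\<Sum>m=0..n. smult (d m) (cheb2 m))"
    using I by (intro sum.mono_neutral_left) (auto simp: d_def)
  finally have "(\<Sum>m=0..n. smult (c m - d m) (cheb2 m)) = 0"
    using eq by (simp add: smult_diff_left sum_subtractf)
  then have cd: "c m = d m" if "m \<le> n" for m
    using cheb2_independent[of "\<lambda>m. c m - d m"] that by fastforce
  show "i \<in> I \<Longrightarrow> c (f i) = a i" using cd I by (auto simp: d_def)
  show "m \<le> n \<Longrightarrow> m \<notin> f ` I \<Longrightarrow> c m = 0" using cd by (auto simp: d_def)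
qed

text \<open>Serves all three ranges of the theorem, with \<open>s\<close> equal to \<open>0\<close>,
  \<open>k - r\<close> and \<open>r\<close>.\<close>

lemma cheb2_expansion_step2_coeffs:
  assumes eq: "(\<Sum>m=0..k. smult (c m) (cheb2 m)) = cheb2 k
      + smult ((1 - lam) / 4) (\<Sum>i=1..s. smult (1 / 4 ^ (i - 1)) (cheb2 (k - 2 * i)))"
    and s: "2 * s \<le> k"
  shows "c k = 1"
    and "1 \<le> i \<Longrightarrow> i \<le> s \<Longrightarrow> c (k - 2 * i) = (1 - lam) / 4 ^ i"
    and "1 \<le> i \<Longrightarrow> i \<le> s \<Longrightarrow> c (k - 2 * i + 1) = 0"
    and "m < k - 2 * s \<Longrightarrow> c m = 0"
proof -
  \<comment> \<open>The value at \<open>0\<close> absorbs the leading \<open>cheb2 k\<close> as the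
    term \<open>i = 0\<close> of a single sum.\<close>
  define a where "a i = (if i = 0 then 1 else (1 - lam) / 4 ^ i)" for i :: nat
  have "smult ((1 - lam) / 4) (\<Sum>i=1..s. smult (1 / 4 ^ (i - 1)) (cheb2 (k - 2 * i)))
      = (\<Sum>i=1..s. smult (a i) (cheb2 (k - 2 * i)))"
    unfolding smult_sum_right
  proof (rule sum.cong)
    fix i assume "i \<in> {1..s}"
    then show "smult ((1 - lam) / 4) (smult (1 / 4 ^ (i - 1)) (cheb2 (k - 2 * i)))
        = smult (a i) (cheb2 (k - 2 * i))"
      by (cases i) (auto simp: a_def)
  qed simp
  then have *: "(\<Sum>m=0..k. smult (c m) (cheb2 m)) = (\<Sum>i=0..s. smult (a i) (cheb2 (k - 2 * i)))"
    unfolding eq by (simp add: sum.atLeast_Suc_atMost[of 0 s] a_def)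
  \<comment> \<open>Since \<open>2 * s \<le> k\<close>, no subtraction is truncated, so distinct
    \<open>i\<close> give distinct indices.\<close>
  have inj: "inj_on (\<lambda>i. k - 2 * i) {0..s}" using s by (auto simp: inj_on_def)
  note uniq = cheb2_expansion_unique[OF * _ inj, simplified]
  show "c k = 1" using uniq(1)[of 0] by (simp add: a_def)
  show "1 \<le> i \<Longrightarrow> i \<le> s \<Longrightarrow> c (k - 2 * i) = (1 - lam) / 4 ^ i"
    using uniq(1)[of i] by (simp add: a_def)
  show "c (k - 2 * i + 1) = 0" if i: "1 \<le> i" "i \<le> s"
  proof (rule uniq(2))
    show "k - 2 * i + 1 \<notin> (\<lambda>i. k - 2 * i) ` {0..s}"
    proof
      assume "k - 2 * i + 1 \<in> (\<lambda>i. k - 2 * i) ` {0..s}"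
      then obtain j where "j \<le> s" "k - 2 * i + 1 = k - 2 * j" by auto
      \<comment> \<open>The two sides have opposite parity.\<close>
      with i s show False by presburger
    qed
  qed (use i s in simp)
  show "m < k - 2 * s \<Longrightarrow> c m = 0" by (rule uniq(2)) auto
qed

theorem proposition3p6:
  fixes r :: nat and lam :: complex and c :: "nat \<Rightarrow> nat \<Rightarrow> complex"
  assumes "r \<ge> 1"
    and "lam \<noteq> 0" and "lam \<noteq> 1"
    and "\<And>n. cheb2_dil lam r n = (\<Sum>m=0..n. smult (c n m) (cheb2 m))"
  shows
    "(\<forall>k\<le>r. cheb2_dil lam r k = cheb2 k \<and> c k k = 1 \<and> (\<forall>m<k. c k m = 0))
   \<and> (\<forall>k. r + 1 \<le> k \<and> k \<le> 2 * r - 1 \<longrightarrow>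
        cheb2_dil lam r k = cheb2 k
          + smult ((1 - lam) / 4) (\<Sum>i=1..k - r. smult (1 / 4 ^ (i - 1)) (cheb2 (k - 2 * i)))
        \<and> c k k = 1
        \<and> (\<forall>i. 1 \<le> i \<and> i \<le> k - r \<longrightarrow>
             c k (k - 2 * i + 1) = 0 \<and> c k (k - 2 * i) = (1 - lam) / 4 ^ i)
        \<and> (\<forall>m \<le> 2 * r - k - 1. c k m = 0))
   \<and> (\<forall>n. cheb2_dil lam r (n + 2 * r) = cheb2 (n + 2 * r)
          + smult ((1 - lam) / 4) (\<Sum>i=1..r. smult (1 / 4 ^ (i - 1)) (cheb2 (n + 2 * (r - i))))
        \<and> c (n + 2 * r) (n + 2 * r) = 1
        \<and> (\<forall>i. 1 \<le> i \<and> i \<le> r \<longrightarrow>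
             c (n + 2 * r) (n + 2 * (r - i) + 1) = 0
             \<and> c (n + 2 * r) (n + 2 * (r - i)) = (1 - lam) / 4 ^ i)
        \<and> (\<forall>m<n. c (n + 2 * r) m = 0))"
proof (safe intro!: conjI allI impI)
  fix k assume k: "k \<le> r"
  show D: "cheb2_dil lam r k = cheb2 k" using cheb2_dil_eq_cheb2[OF k] .
  \<comment> \<open>The empty sum puts the identity into the shape required for
    \<open>s = 0\<close>.\<close>
  have *: "(\<Sum>m=0..k. smult (c k m) (cheb2 m)) = cheb2 k
      + smult ((1 - lam) / 4) (\<Sum>i=1..0. smult (1 / 4 ^ (i - 1)) (cheb2 (k - 2 * i)))"
    using D assms(4)[of k] by simp
  show "c k k = 1" using cheb2_expansion_step2_coeffs(1)[OF *] by simp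
  show "c k m = 0" if "m < k" for m using cheb2_expansion_step2_coeffs(4)[OF *] that by simp
next
  fix k assume k: "r + 1 \<le> k" "k \<le> 2 * r - 1"
  \<comment> \<open>Here \<open>k - r < r\<close>, so the minimum is \<open>k - r\<close>.\<close>
  show D: "cheb2_dil lam r k = cheb2 k
      + smult ((1 - lam) / 4) (\<Sum>i=1..k - r. smult (1 / 4 ^ (i - 1)) (cheb2 (k - 2 * i)))"
    using cheb2_dil_expansion[of r k lam] k by (simp add: min_def split: if_splits)
  have s: "2 * (k - r) \<le> k" using k by simp
  note coeffs = cheb2_expansion_step2_coeffs[OF D[unfolded assms(4)] s]
  show "c k k = 1" by (rule coeffs)
  show "c k (k - 2 * i + 1) = 0" if "1 \<le> i" "i \<le> k - r" for i using coeffs(3) that .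
  show "c k (k - 2 * i) = (1 - lam) / 4 ^ i" if "1 \<le> i" "i \<le> k - r" for i using coeffs(2) that .
  \<comment> \<open>The lowest index present is \<open>k - 2 * (k - r) = 2 * r - k\<close>, which is
    positive.\<close>
  show "c k m = 0" if "m \<le> 2 * r - k - 1" for m using coeffs(4)[of m] that k by simp
next
  fix n
  have ix: "n + 2 * (r - i) = n + 2 * r - 2 * i" if "i \<le> r" for i using that by simp
  \<comment> \<open>Now \<open>k - r = n + r\<close> is at least \<open>r\<close>, so the sum has
    all \<open>r\<close> terms.\<close>
  have D': "cheb2_dil lam r (n + 2 * r) = cheb2 (n + 2 * r)
      + smult ((1 - lam) / 4) (\<Sum>i=1..r. smult (1 / 4 ^ (i - 1)) (cheb2 (n + 2 * r - 2 * i)))"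
    using cheb2_dil_expansion[of r "n + 2 * r" lam] assms(1) by (simp add: min_def)
  then show "cheb2_dil lam r (n + 2 * r) = cheb2 (n + 2 * r)
      + smult ((1 - lam) / 4) (\<Sum>i=1..r. smult (1 / 4 ^ (i - 1)) (cheb2 (n + 2 * (r - i))))"
    by (simp add: ix)
  have s: "2 * r \<le> n + 2 * r" by simp
  note coeffs = cheb2_expansion_step2_coeffs[OF D'[unfolded assms(4)] s]
  show "c (n + 2 * r) (n + 2 * r) = 1" by (rule coeffs)
  show "c (n + 2 * r) (n + 2 * (r - i) + 1) = 0" if "1 \<le> i" "i \<le> r" for i
    using coeffs(3)[OF that] by (simp only: ix[OF that(2)])
  show "c (n + 2 * r) (n + 2 * (r - i)) = (1 - lam) / 4 ^ i" if "1 \<le> i" "i \<le> r" for i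
    using coeffs(2)[OF that] by (simp only: ix[OF that(2)])
  show "c (n + 2 * r) m = 0" if "m < n" for m using coeffs(4) that by simp
qed

end
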